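(* The following problem is undecidable: given a set of constraints $\Sigma$ (TGDs and EGDs), a constraint $\alpha\in\Sigma$, and a database instance $I$, decide whether $\alpha$ is $(I,\Sigma)$-irrelevant.
   Context: **Databases.** Fix pairwise disjoint infinite sets $\Delta$ (constants), $\Delta_{null}$ (labeled nulls), $V$ (variables). A schema is a finite set of relation symbols. A database instance $I$ is a finite (possibly empty) set of atoms over the schema with entries in $\Delta\cup\Delta_{null}$. **Constraints.** All constraint sets are finite. A TGD is a sentence $\forall\overline{x}(\phi(\overline{x})\to\exists\overline{y}\,\psi(\overline{x},\overline{y}))$ with $\phi$ (body, possibly empty) and $\psi$ (head, nonempty) conjunctions of equality-free atoms, possibly with constants from $\Delta$, where every variable of $\overline{x}$ occurring in $\psi$ occurs in $\phi$. An EGD is a sentence $\forall\overline{x}(\phi(\overline{x})\to x_i=x_j)$ with $\phi$ a nonempty conjunction of equality-free atoms (possibly with constants) and $x_i,x_j$ occurring in $\phi$. **Chase.** For a constraint $\alpha$ and a tuple $\overline{a}$ of values for its universally quantified variables, $\alpha(\overline{a})$ denotes the instantiated constraint. A chase step $I\stackrel{\alpha,\overline{a}}{\to}J$ is possible when $I\nvDash\alpha(\overline{a})$. For a TGD, $J$ is obtained by adding the facts of the head instantiated with $\overline{a}$ and with fresh distinct labeled nulls for $\overline{y}$. For an EGD, $J$ is obtained by identifying the two values in question (a labeled null is replaced everywhere by the other value; if both are constants the step cannot be performed). A chase sequence of $I$ with $\Sigma$ is an exhaustive application of chase steps $I=I_0\stackrel{\alpha_0,\overline{a}_0}{\to}I_1\stackrel{\alpha_1,\overline{a}_1}{\to}\cdots$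 with $\alpha_i\in\Sigma$, in arbitrary order. **Irrelevance.** $\alpha\in\Sigma$ is $(I,\Sigma)$-irrelevant iff there is no chase sequence $I\stackrel{\alpha_1,\overline{a}_1}{\to}\cdots\stackrel{\alpha,\overline{a}}{\to}\cdots$ of $I$ with $\Sigma$ in which $\alpha$ is applied in some step. *)

theory Defs
  imports Main "HOL-Library.Nat_Bijection" "HOL-Library.Extended_Nat"
begin

datatype recf = Zero | Succ | Proj nat | Comp recf "recf list" | PrimRec recf recf | Mu recf

text \<open>
  \<open>rec_eval p xs y\<close>: the program \<open>p\<close> halts on the argument list \<open>xs\<close> with result \<open>y\<close>.
  In \<open>PrimRec\<close> and \<open>Mu\<close> the recursion or search argument comes first.
  \<open>Mu f\<close> is unbounded search: \<open>f\<close> has to halt on all arguments below the result.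
\<close>

inductive rec_eval :: "recf \<Rightarrow> nat list \<Rightarrow> nat \<Rightarrow> bool" where
  zero: "rec_eval Zero xs 0"
| succ: "rec_eval Succ [x] (Suc x)"
| proj: "i < length xs \<Longrightarrow> rec_eval (Proj i) xs (xs ! i)"
| comp: "length ys = length gs \<Longrightarrow> (\<And>i. i < length gs \<Longrightarrow> rec_eval (gs ! i) xs (ys ! i)) \<Longrightarrow>
    rec_eval f ys z \<Longrightarrow> rec_eval (Comp f gs) xs z"
| primrec_0: "rec_eval f xs y \<Longrightarrow> rec_eval (PrimRec f g) (0 # xs) y"
| primrec_Suc: "rec_eval (PrimRec f g) (n # xs) r \<Longrightarrow> rec_eval g (n # r # xs) y \<Longrightarrow>
    rec_eval (PrimRec f g) (Suc n # xs) y"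
| mu: "rec_eval f (n # xs) 0 \<Longrightarrow> (\<And>i. i < n \<Longrightarrow> \<exists>y. rec_eval f (i # xs) (Suc y)) \<Longrightarrow>
    rec_eval (Mu f) xs n"

lemma rec_eval_deterministic:
  "rec_eval p xs y \<Longrightarrow> rec_eval p xs z \<Longrightarrow> y = z"
proof (induction arbitrary: z rule: rec_eval.induct)
  case (comp ys gs xs f y)
  from comp.prems show ?case
  proof cases
    case (comp ys')
    then have "ys' = ys"
      using comp.IH(1) \<open>length ys = length gs\<close> by (metis nth_equalityI)
    then show ?thesis using comp comp.IH(2) by blast
  qed
next
  case (primrec_0 f xs y g)
  from primrec_0.prems show ?case by cases (use primrec_0.IH in auto)
next
  case (primrec_Suc f g n xs r y)
  from primrec_Suc.prems show ?case by cases (use primrec_Suc.IH in auto)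
next
  case (mu f n xs)
  from mu.prems show ?case
  proof cases
    case 1: mu
    show ?thesis
    proof (cases n z rule: linorder_cases)
      case less
      then show ?thesis using 1(2) mu.IH(1) by blast
    next
      case greater
      then show ?thesis using 1(1) mu.IH(2) by blast
    qed
  qed
qed (auto elim: rec_eval.cases)

text \<open>
  The problem of deciding \<open>P\<close> for inputs from \<open>D\<close>, presented by their codes, is decidable if some
  program halts with the correct answer on every input from \<open>D\<close>. Nothing is required of the
  program on numbers that are not codes of elements of \<open>D\<close>.
\<close>

definition decidable_on :: "'a set \<Rightarrow> ('a \<Rightarrow> nat) \<Rightarrow> ('a \<Rightarrow> bool) \<Rightarrow> bool" where
  "decidable_on D enc P \<longleftrightarrow> (\<exists>p. \<forall>x\<in>D. rec_eval p [enc x] (if P x then 1 else 0))"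

text \<open>
  Each of the pairwise disjoint sets of constants, labeled nulls and variables is a tagged copy of
  the natural numbers. A relation symbol carries its arity, so that the schema of
  an input is the (finite) set of the symbols that occur in it.
\<close>

datatype val = Const nat | Null nat

datatype trm = Var nat | Cst nat

datatype relsym = Rel (rel_name: nat) (arity: nat)

datatype 'a atom = Atom (rel: relsym) (args: "'a list")

type_synonym fact = "val atom"
type_synonym db_instance = "fact set"
type_synonym valuation = "nat \<Rightarrow> val"

text \<open>
  In \<open>TGD body head\<close> the universally quantified variables are those of the body and the
  existentially quantified ones are those that occur only in the head.
  \<open>EGD body x y\<close> has the conclusion that \<open>x\<close> and \<open>y\<close> are equal.
\<close>

datatype constraint =
    TGD "trm atom list" "trm atom list"
  | EGD "trm atom list" nat nat

definition vars :: "trm atom list \<Rightarrow> nat set" where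
  "vars as = {x. \<exists>A\<in>set as. Var x \<in> set (args A)}"

definition ex_vars :: "trm atom list \<Rightarrow> trm atom list \<Rightarrow> nat set" where
  "ex_vars body head = vars head - vars body"

definition wf_atom :: "'a atom \<Rightarrow> bool" where
  "wf_atom A \<longleftrightarrow> length (args A) = arity (rel A)"

fun wf_constraint :: "constraint \<Rightarrow> bool" where
  "wf_constraint (TGD body head) \<longleftrightarrow>
     head \<noteq> [] \<and> (\<forall>A\<in>set body \<union> set head. wf_atom A)"
| "wf_constraint (EGD body x y) \<longleftrightarrow>
     body \<noteq> [] \<and> (\<forall>A\<in>set body. wf_atom A) \<and> x \<in> vars body \<and> y \<in> vars body"

definition wf_instance :: "db_instance \<Rightarrow> bool" where
  "wf_instance I \<longleftrightarrow> finite I \<and> (\<forall>A\<in>I. wf_atom A)"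

definition nulls :: "db_instance \<Rightarrow> nat set" where
  "nulls I = {n. \<exists>A\<in>I. Null n \<in> set (args A)}"

fun inst_trm :: "valuation \<Rightarrow> trm \<Rightarrow> val" where
  "inst_trm a (Var x) = a x"
| "inst_trm a (Cst c) = Const c"

definition inst :: "valuation \<Rightarrow> trm atom list \<Rightarrow> db_instance" where
  "inst a as = map_atom (inst_trm a) ` set as"

text \<open>
  A tuple for the universally quantified variables is given as a total valuation, of which only
  the values on these variables matter.
\<close>

fun sat :: "db_instance \<Rightarrow> constraint \<Rightarrow> valuation \<Rightarrow> bool" where
  "sat I (TGD body head) a \<longleftrightarrow>
     (inst a body \<subseteq> I \<longrightarrow> (\<exists>b. (\<forall>x\<in>vars body. b x = a x) \<and> inst b head \<subseteq> I))"
| "sat I (EGD body x y) a \<longleftrightarrow> (inst a body \<subseteq> I \<longrightarrow> a x = a y)"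

definition replace_null :: "nat \<Rightarrow> val \<Rightarrow> db_instance \<Rightarrow> db_instance" where
  "replace_null n v I = map_atom (\<lambda>u. if u = Null n then v else u) ` I"

text \<open>
  If an EGD equates two distinct nulls, either of them may be replaced by the other.
  If it equates two distinct constants, there is no step.
\<close>

inductive chase_step :: "db_instance \<Rightarrow> constraint \<Rightarrow> valuation \<Rightarrow> db_instance \<Rightarrow> bool" where
  tgd: "chase_step I (TGD body head) a (I \<union> inst b head)"
    if "\<not> sat I (TGD body head) a"
      and "\<forall>x\<in>vars body. b x = a x"
      and "\<forall>y\<in>ex_vars body head. \<exists>n. b y = Null n \<and> n \<notin> nulls I"
      and "inj_on b (ex_vars body head)"
| egd_left: "chase_step I (EGD body x y) a (replace_null n (a y) I)"
    if "\<not> sat I (EGD body x y) a" and "a x = Null n"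
| egd_right: "chase_step I (EGD body x y) a (replace_null n (a x) I)"
    if "\<not> sat I (EGD body x y) a" and "a y = Null n"

text \<open>
  A chase sequence has \<open>N\<close> steps, where \<open>N\<close> may be infinite; the \<open>i\<close>-th step applies \<open>c i\<close> with
  the tuple \<open>a i\<close>. A finite sequence is exhaustive if no step is possible from its
  last instance.
\<close>

definition chase_sequence ::
  "db_instance \<Rightarrow> constraint set \<Rightarrow> enat \<Rightarrow> (nat \<Rightarrow> db_instance) \<Rightarrow> (nat \<Rightarrow> constraint) \<Rightarrow>
    (nat \<Rightarrow> valuation) \<Rightarrow> bool" where
  "chase_sequence I \<Sigma> N J c a \<longleftrightarrow>
     J 0 = I \<and>
     (\<forall>i. enat i < N \<longrightarrow> c i \<in> \<Sigma> \<and> chase_step (J i) (c i) (a i) (J (Suc i))) \<and>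
     (\<forall>n. N = enat n \<longrightarrow> \<not> (\<exists>\<beta>\<in>\<Sigma>. \<exists>b K. chase_step (J n) \<beta> b K))"

definition irrelevant :: "db_instance \<Rightarrow> constraint set \<Rightarrow> constraint \<Rightarrow> bool" where
  "irrelevant I \<Sigma> \<alpha> \<longleftrightarrow>
     \<not> (\<exists>N J c a. chase_sequence I \<Sigma> N J c a \<and> (\<exists>i. enat i < N \<and> c i = \<alpha>))"

text \<open>The finite sets of constraints and of facts are presented as lists.\<close>

type_synonym input = "constraint list \<times> constraint \<times> fact list"

definition valid_inputs :: "input set" where
  "valid_inputs =
     {(\<Sigma>, \<alpha>, I). (\<forall>\<beta>\<in>set \<Sigma>. wf_constraint \<beta>) \<and> \<alpha> \<in> set \<Sigma> \<and> wf_instance (set I)}"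

fun encode_val :: "val \<Rightarrow> nat" where
  "encode_val (Const n) = sum_encode (Inl n)"
| "encode_val (Null n) = sum_encode (Inr n)"

fun encode_trm :: "trm \<Rightarrow> nat" where
  "encode_trm (Var n) = sum_encode (Inl n)"
| "encode_trm (Cst n) = sum_encode (Inr n)"

fun encode_atom :: "('a \<Rightarrow> nat) \<Rightarrow> 'a atom \<Rightarrow> nat" where
  "encode_atom e (Atom (Rel r k) ts) =
     prod_encode (prod_encode (r, k), list_encode (map e ts))"

definition encode_atoms :: "('a \<Rightarrow> nat) \<Rightarrow> 'a atom list \<Rightarrow> nat" where
  "encode_atoms e as = list_encode (map (encode_atom e) as)"

fun encode_constraint :: "constraint \<Rightarrow> nat" where
  "encode_constraint (TGD body head) =
     sum_encode (Inl (prod_encode (encode_atoms encode_trm body, encode_atoms encode_trm head)))"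
| "encode_constraint (EGD body x y) =
     sum_encode (Inr (prod_encode (encode_atoms encode_trm body, prod_encode (x, y))))"

fun encode_input :: "input \<Rightarrow> nat" where
  "encode_input (\<Sigma>, \<alpha>, I) =
     prod_encode (list_encode (map encode_constraint \<Sigma>),
       prod_encode (encode_constraint \<alpha>, encode_atoms encode_val I))"

lemma inj_encode_val: "inj encode_val"
proof (rule injI)
  fix u v assume "encode_val u = encode_val v"
  then show "u = v" by (cases u; cases v) (auto simp only: encode_val.simps sum_encode_eq)
qed

lemma inj_encode_trm: "inj encode_trm"
proof (rule injI)
  fix s t assume "encode_trm s = encode_trm t"
  then show "s = t" by (cases s; cases t) (auto simp only: encode_trm.simps sum_encode_eq)
qed

lemma inj_encode_atom: "inj e \<Longrightarrow> inj (encode_atom e)"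
proof (rule injI)
  fix A B assume "inj e" "encode_atom e A = encode_atom e B"
  then show "A = B"
    by (cases "(e, A)" rule: encode_atom.cases; cases "(e, B)" rule: encode_atom.cases)
      (auto simp: prod_encode_eq list_encode_eq inj_map_eq_map)
qed

lemma inj_encode_atoms: "inj e \<Longrightarrow> inj (encode_atoms e)"
  by (rule injI) (simp add: encode_atoms_def list_encode_eq inj_map_eq_map inj_encode_atom)

lemma inj_encode_constraint: "inj encode_constraint"
proof (rule injI)
  fix \<alpha> \<beta> assume "encode_constraint \<alpha> = encode_constraint \<beta>"
  then show "\<alpha> = \<beta>"
    by (cases \<alpha>; cases \<beta>)
      (auto simp only: encode_constraint.simps sum_encode_eq prod_encode_eq prod.inject
        sum.inject sum.distinct inj_eq[OF inj_encode_atoms[OF inj_encode_trm]])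
qed

lemma inj_encode_input: "inj encode_input"
proof (rule injI)
  fix x y :: input assume "encode_input x = encode_input y"
  then show "x = y"
    by (cases x; cases y)
      (auto simp: prod_encode_eq list_encode_eq inj_map_eq_map[OF inj_encode_constraint]
        inj_eq[OF inj_encode_constraint] inj_eq[OF inj_encode_atoms[OF inj_encode_val]])
qed

end

(*
  Evaluation of a recursive function D on n can be simulated by the chase: the evaluation rules for
  D are TGDs, a TGD creates successors, and n is given by a chain of n successor facts. A goal rule
  is applicable in some chase sequence iff D outputs 1 on n: every instance of the chase maps
  homomorphically into the standard model over the natural numbers, and conversely each finite
  evaluation can be replayed by chase steps.

  No universal program is needed for the diagonal argument. If p decides irrelevance, let D map n to
  the answer of p on the input whose constraint set has code n, with the fixed goal rule and the
  instance for n. If n is the code of the constraints for D itself, then D outputs 1 on n iff the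
  goal rule is irrelevant, that is, iff D does not output 1 on n.
*)

theory Submission
  imports Defs
begin

section \<open>Computable functions\<close>

text \<open>Functions take the whole argument list, so that the closure lemmas below serve as
  introduction rules for terms of the form \<open>\<lambda>xs. ...\<close>.\<close>

definition computable :: "nat \<Rightarrow> (nat list \<Rightarrow> nat) \<Rightarrow> bool" where
  "computable k f \<longleftrightarrow> (\<exists>p. \<forall>xs. length xs = k \<longrightarrow> rec_eval p xs (f xs))"

lemma computable_cong:
  "(\<And>xs. length xs = k \<Longrightarrow> f xs = g xs) \<Longrightarrow> computable k f \<longleftrightarrow> computable k g"
  by (simp add: computable_def)

lemma computable_nth: "i < k \<Longrightarrow> computable k (\<lambda>xs. xs ! i)"
  unfolding computable_def by (metis rec_eval.proj)

lemma computable_comp1: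
  assumes "computable 1 (\<lambda>ys. g (ys ! 0))" "computable k f"
  shows "computable k (\<lambda>xs. g (f xs))"
proof -
  from assms obtain p q where p: "\<And>ys. length ys = 1 \<Longrightarrow> rec_eval p ys (g (ys ! 0))"
    and q: "\<And>xs. length xs = k \<Longrightarrow> rec_eval q xs (f xs)"
    unfolding computable_def by metis
  have "rec_eval (Comp p [q]) xs (g (f xs))" if "length xs = k" for xs
    using p[of "[f xs]"] q[OF that] by (intro rec_eval.comp[of "[f xs]"]) auto
  then show ?thesis unfolding computable_def by blast
qed

lemma computable_comp2:
  assumes "computable 2 (\<lambda>ys. h (ys ! 0) (ys ! 1))" "computable k f" "computable k g"
  shows "computable k (\<lambda>xs. h (f xs) (g xs))"
proof -
  from assms obtain p q r
    where p: "\<And>ys. length ys = 2 \<Longrightarrow> rec_eval p ys (h (ys ! 0) (ys ! 1))"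
    and q: "\<And>xs. length xs = k \<Longrightarrow> rec_eval q xs (f xs)"
    and r: "\<And>xs. length xs = k \<Longrightarrow> rec_eval r xs (g xs)"
    unfolding computable_def by metis
  have "rec_eval (Comp p [q, r]) xs (h (f xs) (g xs))" if "length xs = k" for xs
    using p[of "[f xs, g xs]"] q[OF that] r[OF that]
    by (intro rec_eval.comp[of "[f xs, g xs]"]) (auto simp: less_Suc_eq)
  then show ?thesis unfolding computable_def by blast
qed

lemma computable_Suc:
  assumes "computable k f"
  shows "computable k (\<lambda>xs. Suc (f xs))"
proof -
  have "rec_eval Succ ys (Suc (ys ! 0))" if "length ys = 1" for ys
    using that by (auto simp: length_Suc_conv intro: rec_eval.succ)
  then have "computable 1 (\<lambda>ys. Suc (ys ! 0))" unfolding computable_def by blast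
  from computable_comp1[OF this assms] show ?thesis .
qed

lemma computable_const: "computable k (\<lambda>xs. c)"
proof (induction c)
  case 0
  show ?case unfolding computable_def by (meson rec_eval.zero)
qed (rule computable_Suc)

lemma computable_primrec:
  assumes "computable k f" "computable (k + 2) (\<lambda>xs. g (xs ! 0) (xs ! 1) (drop 2 xs))"
  shows "computable (Suc k) (\<lambda>xs. rec_nat (f (tl xs)) (\<lambda>n r. g n r (tl xs)) (hd xs))"
proof -
  from assms obtain p q where p: "\<And>xs. length xs = k \<Longrightarrow> rec_eval p xs (f xs)"
    and q: "\<And>xs. length xs = k + 2 \<Longrightarrow> rec_eval q xs (g (xs ! 0) (xs ! 1) (drop 2 xs))"
    unfolding computable_def by metis
  have "rec_eval (PrimRec p q) (n # xs) (rec_nat (f xs) (\<lambda>n r. g n r xs) n)"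
    if "length xs = k" for n xs
  proof (induction n)
    case 0
    show ?case using p[OF that] by (auto intro: rec_eval.primrec_0)
  next
    case (Suc n)
    let ?r = "rec_nat (f xs) (\<lambda>n r. g n r xs) n"
    show ?case
      using q[of "n # ?r # xs"] that by (auto intro: rec_eval.primrec_Suc[OF Suc])
  qed
  then have "rec_eval (PrimRec p q) xs (rec_nat (f (tl xs)) (\<lambda>n r. g n r (tl xs)) (hd xs))"
    if "length xs = Suc k" for xs
    using that by (cases xs) auto
  then show ?thesis unfolding computable_def by blast
qed

lemma computable_add:
  assumes "computable k f" "computable k g"
  shows "computable k (\<lambda>xs. f xs + g xs)"
proof -
  have "computable (Suc 1) (\<lambda>xs. rec_nat (tl xs ! 0) (\<lambda>n r. Suc r) (hd xs))"
    by (intro computable_primrec[where g = "\<lambda>n r xs. Suc r"] computable_Suc computable_nth) auto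
  moreover have "rec_nat b (\<lambda>n r. Suc r) a = a + b" for a b :: nat
    by (induction a) auto
  ultimately have "computable 2 (\<lambda>xs. hd xs + tl xs ! 0)" by (simp add: numeral_2_eq_2)
  then have "computable 2 (\<lambda>xs. xs ! 0 + xs ! 1)"
    by (rule computable_cong[THEN iffD1, rotated]) (auto simp: length_Suc_conv numeral_2_eq_2)
  from computable_comp2[OF this assms] show ?thesis .
qed

text \<open>Recursion without parameters and with a constant start: the triangle numbers and the
  code of the successor chain both have this form.\<close>

lemma computable_rec_nat:
  assumes "computable 2 (\<lambda>xs. g (xs ! 0) (xs ! 1))" "computable k f"
  shows "computable k (\<lambda>xs. rec_nat c g (f xs))"
proof -
  have "computable (Suc 0) (\<lambda>xs. rec_nat c (\<lambda>n r. g n r) (hd xs))"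
    using computable_primrec[where g = "\<lambda>n r xs. g n r" and f = "\<lambda>xs. c" and k = 0] assms(1)
    by (simp add: computable_const numeral_2_eq_2)
  then have "computable 1 (\<lambda>xs. rec_nat c g (xs ! 0))"
    using computable_cong[of 1 "\<lambda>xs. rec_nat c g (hd xs)" "\<lambda>xs. rec_nat c g (xs ! 0)"]
    by (simp add: length_Suc_conv) force
  from computable_comp1[OF this assms(2)] show ?thesis .
qed

lemma computable_prod_encode:
  assumes "computable k f" "computable k g"
  shows "computable k (\<lambda>xs. prod_encode (f xs, g xs))"
proof -
  \<comment> \<open>\<open>prod_encode (a, b)\<close> is \<open>triangle (a + b) + a\<close>, so
    only \<open>triangle\<close> has to be recast as a recursion.\<close>
  have tri: "triangle n = rec_nat 0 (\<lambda>n r. Suc (n + r)) n" for n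
    by (induction n) auto
  show ?thesis
    unfolding prod_encode_def prod.case tri
    by (intro computable_add computable_rec_nat computable_Suc computable_nth assms) auto
qed

section \<open>Evaluation rules as dependencies\<close>

text \<open>Each subprogram gets relations of its own, so programs need not be coded as values
  inside facts. Countability supplies the numeric relation names.\<close>

datatype sym = Num | Successor | Start | Accept | Goal | Result recf | Positive_below recf

instance recf :: countable by countable_datatype
instance sym :: countable by countable_datatype

definition mk_atom :: "sym \<Rightarrow> 'a list \<Rightarrow> 'a atom" where
  "mk_atom s ts = Atom (Rel (to_nat s) (length ts)) ts"

lemma set_atom_eq: "set_atom A = set (args A)"
  by (cases A) auto

lemma mk_atom_simps [simp]:
  "mk_atom s ts = mk_atom s' ts' \<longleftrightarrow> s = s' \<and> ts = ts'"
  "map_atom f (mk_atom s ts) = mk_atom s (map f ts)"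
  "args (mk_atom s ts) = ts"
  "wf_atom (mk_atom s ts)"
  by (auto simp: mk_atom_def wf_atom_def)

definition tuple :: "nat \<Rightarrow> trm list" where
  "tuple k = map Var [0..<k]"

definition nums :: "nat \<Rightarrow> trm atom list" where
  "nums k = map (\<lambda>i. mk_atom Num [Var i]) [0..<k]"

text \<open>
  Results come first in the argument list of \<open>Result q\<close>. The constant \<open>Cst 0\<close> stands for the number 0.
  \<open>Positive_below f (z # xs)\<close> says that \<open>f\<close> has positive values on \<open>i # xs\<close> for all \<open>i < z\<close>.
  The atoms in \<open>nums k\<close> keep the parameters of a rule from being existentially quantified.
\<close>

fun rules :: "recf \<Rightarrow> nat \<Rightarrow> constraint list" where
  "rules Zero k = [TGD (nums k) [mk_atom (Result Zero) (Cst 0 # tuple k)]]"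
| "rules Succ k = [TGD [mk_atom Successor [Var 0, Var 1]] [mk_atom (Result Succ) [Var 1, Var 0]]]"
| "rules (Proj i) k =
     (if i < k then [TGD (nums k) [mk_atom (Result (Proj i)) (Var i # tuple k)]] else [])"
| "rules (Comp f gs) k =
     TGD (mk_atom (Result f) (Var (k + length gs) # map Var [k..<k + length gs]) #
          map (\<lambda>j. mk_atom (Result (gs ! j)) (Var (k + j) # tuple k)) [0..<length gs] @ nums k)
       [mk_atom (Result (Comp f gs)) (Var (k + length gs) # tuple k)] #
     rules f (length gs) @ concat (map (\<lambda>g. rules g k) gs)"
| "rules (PrimRec f g) 0 = []"
| "rules (PrimRec f g) (Suc k) =
     TGD [mk_atom (Result f) (Var k # tuple k)]
       [mk_atom (Result (PrimRec f g)) (Var k # Cst 0 # tuple k)] #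
     TGD [mk_atom (Result (PrimRec f g)) (Var k # Var (k + 1) # tuple k),
          mk_atom (Result g) (Var (k + 2) # Var (k + 1) # Var k # tuple k),
          mk_atom Successor [Var (k + 1), Var (k + 3)]]
       [mk_atom (Result (PrimRec f g)) (Var (k + 2) # Var (k + 3) # tuple k)] #
     rules f k @ rules g (k + 2)"
| "rules (Mu f) k =
     TGD (nums k) [mk_atom (Positive_below f) (Cst 0 # tuple k)] #
     TGD [mk_atom (Positive_below f) (Var k # tuple k),
          mk_atom (Result f) (Var (k + 1) # Var k # tuple k),
          mk_atom Successor [Var (k + 2), Var (k + 1)],
          mk_atom Successor [Var k, Var (k + 3)]]
       [mk_atom (Positive_below f) (Var (k + 3) # tuple k)] #
     TGD [mk_atom (Positive_below f) (Var k # tuple k),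
          mk_atom (Result f) (Cst 0 # Var k # tuple k)]
       [mk_atom (Result (Mu f)) (Var k # tuple k)] #
     rules f (Suc k)"

text \<open>The second rule admits the constants of the input chain as numbers. The third is the
  only rule of \<open>program_rules D\<close> with an existential variable; it supplies successors
  beyond the chain.\<close>

definition number_rules :: "constraint list" where
  "number_rules =
     [TGD [] [mk_atom Num [Cst 0]],
      TGD [mk_atom Successor [Var 0, Var 1]] [mk_atom Num [Var 1]],
      TGD [mk_atom Num [Var 0]] [mk_atom Successor [Var 0, Var 1], mk_atom Num [Var 1]]]"

text \<open>The output 1 may be represented by a null instead of \<open>Const 1\<close>, so it is
  recognised as a successor of the constant 0.\<close>

definition accept_rule :: "recf \<Rightarrow> constraint" where
  "accept_rule D =
     TGD [mk_atom Start [Var 0], mk_atom (Result D) [Var 1, Var 0], mk_atom Successor [Cst 0, Var 1]]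
       [mk_atom Accept []]"

text \<open>Splitting this rule from \<open>accept_rule\<close> makes it independent of
  \<open>D\<close>, so that its code is a constant in the diagonal argument.\<close>

definition goal_rule :: constraint where
  "goal_rule = TGD [mk_atom Accept []] [mk_atom Goal []]"

definition program_rules :: "recf \<Rightarrow> constraint list" where
  "program_rules D = goal_rule # accept_rule D # number_rules @ rules D 1"

primrec successor_chain :: "nat \<Rightarrow> fact list" where
  "successor_chain 0 = []"
| "successor_chain (Suc n) = mk_atom Successor [Const n, Const (Suc n)] # successor_chain n"

definition input_facts :: "nat \<Rightarrow> fact list" where
  "input_facts n = mk_atom Start [Const n] # successor_chain n"

section \<open>Validity and computable codes of the inputs\<close>

lemma wf_nums: "A \<in> set (nums k) \<Longrightarrow> wf_atom A"
  by (auto simp: nums_def)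

lemma wf_rules: "\<beta> \<in> set (rules q k) \<Longrightarrow> wf_constraint \<beta>"
  by (induction q k rule: rules.induct) (auto split: if_splits dest: wf_nums)

lemma wf_program_rules: "\<beta> \<in> set (program_rules D) \<Longrightarrow> wf_constraint \<beta>"
  by (auto simp: program_rules_def goal_rule_def accept_rule_def number_rules_def dest: wf_rules)

lemma wf_input_facts: "wf_instance (set (input_facts n))"
proof -
  have "wf_atom A" if "A \<in> set (successor_chain n)" for A
    using that by (induction n) auto
  then show ?thesis by (auto simp: wf_instance_def input_facts_def)
qed

lemma valid_input: "(program_rules D, goal_rule, input_facts n) \<in> valid_inputs"
  using wf_program_rules wf_input_facts by (auto simp: valid_inputs_def program_rules_def)

text \<open>The argument itself takes the place of the code of the constraint list, so no program
  text has to be processed. Only the code of the input facts is computed, by recursion along the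
  chain.\<close>

lemma computable_input_code:
  "computable 1 (\<lambda>xs. prod_encode (xs ! 0,
     prod_encode (encode_constraint goal_rule, encode_atoms encode_val (input_facts (xs ! 0)))))"
proof -
  \<comment> \<open>\<open>?g\<close> prepends the code of one successor fact: 0 codes the empty
    list, \<open>Suc (prod_encode (x, r))\<close> codes a cons, and \<open>n + n\<close> is
    \<open>encode_val (Const n)\<close>.\<close>
  let ?g = "\<lambda>n r. Suc (prod_encode (prod_encode (prod_encode (to_nat Successor, 2),
    Suc (prod_encode (n + n, Suc (prod_encode (Suc n + Suc n, 0))))), r))"
  have chain: "list_encode (map (encode_atom encode_val) (successor_chain n)) = rec_nat 0 ?g n" for n
    by (induction n) (simp_all add: mk_atom_def sum_encode_def numeral_2_eq_2 mult_2)
  have code: "encode_atoms encode_val (input_facts n) =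
      Suc (prod_encode (prod_encode (prod_encode (to_nat Start, 1),
        Suc (prod_encode (n + n, 0))), rec_nat 0 ?g n))" for n
    by (simp add: encode_atoms_def input_facts_def chain mk_atom_def sum_encode_def mult_2)
  have "computable 2 (\<lambda>xs. ?g (xs ! 0) (xs ! 1))"
    by (intro computable_Suc computable_prod_encode computable_add computable_const computable_nth)
      auto
  then show ?thesis
    unfolding code
    by (intro computable_prod_encode computable_Suc computable_add computable_rec_nat
        computable_const computable_nth) auto
qed

section \<open>Soundness: homomorphisms into the standard model\<close>

primrec eval_trm :: "(nat \<Rightarrow> nat) \<Rightarrow> trm \<Rightarrow> nat" where
  "eval_trm \<nu> (Var x) = \<nu> x"
| "eval_trm \<nu> (Cst c) = c"

definition ground :: "(nat \<Rightarrow> nat) \<Rightarrow> trm atom list \<Rightarrow> nat atom set" where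
  "ground \<nu> as = map_atom (eval_trm \<nu>) ` set as"

text \<open>For EGDs this is stronger than truth in \<open>M\<close>: the body must never hold,
  which excludes EGD steps from any instance that maps into \<open>M\<close>.\<close>

fun models :: "nat atom set \<Rightarrow> constraint \<Rightarrow> bool" where
  "models M (TGD body head) \<longleftrightarrow>
     (\<forall>\<nu>. ground \<nu> body \<subseteq> M \<longrightarrow> (\<exists>\<nu>'. (\<forall>x\<in>vars body. \<nu>' x = \<nu> x) \<and> ground \<nu>' head \<subseteq> M))"
| "models M (EGD body x y) \<longleftrightarrow> (\<forall>\<nu>. \<not> ground \<nu> body \<subseteq> M)"

lemma models_datalog:
  "(\<And>\<nu>. ground \<nu> body \<subseteq> M \<Longrightarrow> ground \<nu> head \<subseteq> M) \<Longrightarrow> models M (TGD body head)"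
  by auto

definition hom :: "(val \<Rightarrow> nat) \<Rightarrow> db_instance \<Rightarrow> nat atom set \<Rightarrow> bool" where
  "hom \<mu> I M \<longleftrightarrow> (\<forall>c. \<mu> (Const c) = c) \<and> map_atom \<mu> ` I \<subseteq> M"

lemma hom_inst:
  assumes "\<And>c. \<mu> (Const c) = c"
  shows "map_atom \<mu> ` inst a as = ground (\<mu> \<circ> a) as"
proof -
  have "\<mu> \<circ> inst_trm a = eval_trm (\<mu> \<circ> a)"
  proof
    fix t show "(\<mu> \<circ> inst_trm a) t = eval_trm (\<mu> \<circ> a) t" using assms by (cases t) auto
  qed
  then show ?thesis by (simp add: inst_def ground_def image_image atom.map_comp)
qed

lemma ground_cong: "(\<And>x. x \<in> vars as \<Longrightarrow> \<nu> x = \<nu>' x) \<Longrightarrow> ground \<nu> as = ground \<nu>' as"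
proof -
  assume eq: "\<And>x. x \<in> vars as \<Longrightarrow> \<nu> x = \<nu>' x"
  have "eval_trm \<nu> t = eval_trm \<nu>' t" if "A \<in> set as" "t \<in> set (args A)" for A t
    using that eq by (cases t) (auto simp: vars_def)
  then show ?thesis
    unfolding ground_def by (intro image_cong refl atom.map_cong0) (auto simp: set_atom_eq)
qed

text \<open>The image of the rule body lies in \<open>M\<close>, so \<open>M\<close> offers
  witnesses for the head. The nulls created by the step are fresh, hence free to be mapped to these
  witnesses.\<close>

lemma chase_step_hom:
  assumes step: "chase_step J \<beta> a K" and "models M \<beta>" and \<mu>: "hom \<mu> J M"
  shows "\<exists>\<mu>'. hom \<mu>' K M"
  using step
proof cases
  case (tgd body head b)
  from \<mu> have \<mu>c: "\<mu> (Const c) = c" and \<mu>J: "map_atom \<mu> ` J \<subseteq> M" for c by (auto simp: hom_def)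
  from tgd(3) have "inst a body \<subseteq> J" by auto
  then have "ground (\<mu> \<circ> a) body \<subseteq> M" using \<mu>J by (simp flip: hom_inst[OF \<mu>c]) blast
  with \<open>models M \<beta>\<close> obtain \<nu> where \<nu>: "\<forall>x\<in>vars body. \<nu> x = \<mu> (a x)" "ground \<nu> head \<subseteq> M"
    unfolding tgd(1) by auto
  let ?E = "ex_vars body head"
  \<comment> \<open>Injectivity of \<open>b\<close> on the existential variables makes this a
    consistent redefinition on the fresh nulls.\<close>
  define \<mu>' where "\<mu>' v = (if v \<in> b ` ?E then \<nu> (inv_into ?E b v) else \<mu> v)" for v
  have c: "\<mu>' (Const c) = c" for c
    using tgd(5) \<mu>c by (auto simp: \<mu>'_def)
  have "\<mu>' (b x) = \<nu> x" if "x \<in> vars head" for x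
  proof (cases "x \<in> vars body")
    case True
    \<comment> \<open>The value of a body variable occurs in \<open>J\<close>, so it is none of the
      fresh nulls.\<close>
    have "\<mu>' (a x) = \<mu> (a x)"
    proof -
      have "a x \<notin> b ` ?E"
      proof
        assume "a x \<in> b ` ?E"
        then obtain n where n: "a x = Null n" "n \<notin> nulls J" using tgd(5) by auto
        from True obtain A where A: "A \<in> set body" "Var x \<in> set (args A)" by (auto simp: vars_def)
        then have "map_atom (inst_trm a) A \<in> J" using \<open>inst a body \<subseteq> J\<close> by (auto simp: inst_def)
        moreover have "inst_trm a (Var x) \<in> set (args (map_atom (inst_trm a) A))"
          using A(2) by (cases A) (auto simp del: inst_trm.simps)
        ultimately show False using n by (force simp: nulls_def)
      qed
      then show ?thesis by (simp add: \<mu>'_def)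
    qed
    then show ?thesis using True \<nu>(1) tgd(4) by simp
  next
    case False
    then have "x \<in> ?E" using that by (simp add: ex_vars_def)
    then show ?thesis using tgd(6) by (simp add: \<mu>'_def)
  qed
  then have "ground (\<mu>' \<circ> b) head = ground \<nu> head" by (intro ground_cong) simp
  then have "map_atom \<mu>' ` inst b head \<subseteq> M" using \<nu>(2) by (simp add: hom_inst[OF c])
  moreover have "map_atom \<mu>' A = map_atom \<mu> A" if "A \<in> J" for A
  proof (rule atom.map_cong0)
    fix v assume "v \<in> set_atom A"
    then have v: "v \<in> set (args A)" by (simp add: set_atom_eq)
    have "v \<notin> b ` ?E"
      using v that tgd(5) by (force simp: nulls_def)
    then show "\<mu>' v = \<mu> v" by (simp add: \<mu>'_def)
  qed
  then have "map_atom \<mu>' ` J \<subseteq> M" using \<mu>J by auto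
  ultimately show ?thesis using c tgd(2) by (auto simp: hom_def intro!: exI[of _ \<mu>'])
next
  case (egd_left body x y n)
  then have "inst a body \<subseteq> J" by auto
  then have "ground (\<mu> \<circ> a) body \<subseteq> M"
    using \<mu> by (simp add: hom_def flip: hom_inst) blast
  then show ?thesis using \<open>models M \<beta>\<close> egd_left by auto
next
  case (egd_right body x y n)
  then have "inst a body \<subseteq> J" by auto
  then have "ground (\<mu> \<circ> a) body \<subseteq> M"
    using \<mu> by (simp add: hom_def flip: hom_inst) blast
  then show ?thesis using \<open>models M \<beta>\<close> egd_right by auto
qed

lemma chase_sequence_hom:
  assumes "chase_sequence I \<Sigma> N J c a" "\<And>\<beta>. \<beta> \<in> \<Sigma> \<Longrightarrow> models M \<beta>" "hom \<mu> I M" "enat i \<le> N"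
  shows "\<exists>\<mu>'. hom \<mu>' (J i) M"
  using assms(4)
proof (induction i)
  case 0
  then show ?case using assms(1,3) by (auto simp: chase_sequence_def)
next
  case (Suc i)
  then have "enat i < N" by (simp add: Suc_ile_eq)
  with Suc.IH assms(1,2) show ?case
    unfolding chase_sequence_def by (metis chase_step_hom order_less_imp_le)
qed

text \<open>The intended reading of the relations over the natural numbers. \<open>Goal\<close> may
  hold unconditionally, since soundness only concerns \<open>Accept\<close>, the body of
  \<open>goal_rule\<close>.\<close>

primrec holds :: "recf \<Rightarrow> nat \<Rightarrow> sym \<Rightarrow> nat list \<Rightarrow> bool" where
  "holds D n Num ts \<longleftrightarrow> True"
| "holds D n Successor ts \<longleftrightarrow> ts ! 1 = Suc (ts ! 0)"
| "holds D n Start ts \<longleftrightarrow> ts ! 0 = n"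
| "holds D n Accept ts \<longleftrightarrow> rec_eval D [n] 1"
| "holds D n Goal ts \<longleftrightarrow> True"
| "holds D n (Result q) ts \<longleftrightarrow> rec_eval q (tl ts) (hd ts)"
| "holds D n (Positive_below f) ts \<longleftrightarrow> (\<forall>i<hd ts. \<exists>y. rec_eval f (i # tl ts) (Suc y))"

definition standard_model :: "recf \<Rightarrow> nat \<Rightarrow> nat atom set" where
  "standard_model D n = {mk_atom s ts |s ts. holds D n s ts}"

lemma mk_atom_standard_model [simp]: "mk_atom s ts \<in> standard_model D n \<longleftrightarrow> holds D n s ts"
  by (auto simp: standard_model_def)

lemma map_eval_tuple [simp]: "map (eval_trm \<nu>) (tuple k) = map \<nu> [0..<k]"
  by (simp add: tuple_def)

lemma proj_map: "i < k \<Longrightarrow> rec_eval (Proj i) (map \<nu> [0..<k]) (\<nu> i)"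
  using rec_eval.proj[of i "map \<nu> [0..<k]"] by simp

text \<open>Under the intended reading each rule is an introduction rule of \<open>rec_eval\<close>,
  or a step of the search behind \<open>Mu\<close>.\<close>

lemma standard_model_rules: "\<beta> \<in> set (rules q k) \<Longrightarrow> models (standard_model D n) \<beta>"
proof (induction q k rule: rules.induct)
  case (4 f gs k)
  let ?m = "length gs"
  have "models (standard_model D n)
    (TGD (mk_atom (Result f) (Var (k + ?m) # map Var [k..<k + ?m]) #
          map (\<lambda>j. mk_atom (Result (gs ! j)) (Var (k + j) # tuple k)) [0..<?m] @ nums k)
       [mk_atom (Result (Comp f gs)) (Var (k + ?m) # tuple k)])" (is "models _ (TGD ?body ?head)")
  proof (rule models_datalog)
    fix \<nu> assume body: "ground \<nu> ?body \<subseteq> standard_model D n"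
    let ?ys = "map \<nu> [k..<k + ?m]"
    have "rec_eval (gs ! j) (map \<nu> [0..<k]) (?ys ! j)" if "j < ?m" for j
      using body that by (auto simp: ground_def image_Un image_image image_subset_iff)
    moreover have "rec_eval f ?ys (\<nu> (k + ?m))"
      using body by (simp add: ground_def comp_def)
    ultimately show "ground \<nu> ?head \<subseteq> standard_model D n"
      using rec_eval.comp[of ?ys gs "map \<nu> [0..<k]" f "\<nu> (k + ?m)"] by (simp add: ground_def)
  qed
  with 4 show ?case by auto
next
  \<comment> \<open>The case of \<open>Mu\<close>: a positive value at the current bound raises the
    bound by one, and a zero there completes the premises of \<open>rec_eval.mu\<close>.\<close>
  case (7 f k)
  have "models (standard_model D n) \<beta>" if "\<beta> \<notin> set (rules f (Suc k))"
    using 7(2) that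
    by (auto intro!: models_datalog rec_eval.mu simp: ground_def less_Suc_eq
        simp del: models.simps) metis
  with 7(1) show ?case by blast
qed (auto intro!: models_datalog simp: ground_def simp del: models.simps split: if_splits
    intro: rec_eval.intros proj_map)

lemma standard_model_program_rules:
  "\<beta> \<in> set (program_rules D) \<Longrightarrow> models (standard_model D n) \<beta>"
proof -
  \<comment> \<open>Witness for the existential variable of the rule that creates
    successors.\<close>
  have "\<exists>\<nu>'. \<nu>' 0 = \<nu> 0 \<and> \<nu>' (Suc 0) = Suc (\<nu>' 0)" for \<nu> :: "nat \<Rightarrow> nat"
    by (rule exI[of _ "\<nu>(1 := Suc (\<nu> 0))"]) simp
  then show "\<beta> \<in> set (program_rules D) \<Longrightarrow> models (standard_model D n) \<beta>"
    using standard_model_rules[of \<beta> D 1 D n]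
    by (auto simp: program_rules_def goal_rule_def accept_rule_def number_rules_def ground_def
        vars_def)
qed

text \<open>The input facts contain constants only, so the value 0 for nulls is arbitrary.\<close>

lemma hom_input_facts: "hom (case_val id (\<lambda>_. 0)) (set (input_facts n)) (standard_model D n)"
proof -
  have "map_atom (case_val id (\<lambda>_. 0)) ` set (successor_chain k) \<subseteq> standard_model D n" for k
    by (induction k) auto
  then show ?thesis by (simp add: hom_def input_facts_def)
qed

text \<open>Applying \<open>goal_rule\<close> presupposes the fact \<open>Accept\<close>, whose
  image in the standard model says that \<open>D\<close> outputs 1 on \<open>n\<close>.\<close>

lemma relevant_imp_accepts:
  assumes "\<not> irrelevant (set (input_facts n)) (set (program_rules D)) goal_rule"
  shows "rec_eval D [n] 1"
proof -
  from assms obtain N J c a i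
    where seq: "chase_sequence (set (input_facts n)) (set (program_rules D)) N J c a"
    and i: "enat i < N" "c i = goal_rule"
    unfolding irrelevant_def by blast
  obtain \<mu> where \<mu>: "hom \<mu> (J i) (standard_model D n)"
    using chase_sequence_hom[OF seq standard_model_program_rules hom_input_facts] i(1) by force
  have "chase_step (J i) goal_rule (a i) (J (Suc i))"
    using seq i by (auto simp: chase_sequence_def)
  then have "\<not> sat (J i) goal_rule (a i)" by (auto elim: chase_step.cases)
  then have "mk_atom Accept [] \<in> J i" by (auto simp: goal_rule_def inst_def)
  then have "map_atom \<mu> (mk_atom Accept []) \<in> standard_model D n"
    using \<mu> unfolding hom_def by blast
  then show ?thesis by simp
qed

section \<open>Completeness: deriving all results by chase steps\<close>

definition step :: "constraint set \<Rightarrow> db_instance \<Rightarrow> db_instance \<Rightarrow> bool" where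
  "step \<Sigma> J K \<longleftrightarrow> (\<exists>\<beta>\<in>\<Sigma>. \<exists>a. chase_step J \<beta> a K)"

text \<open>Finiteness guarantees fresh nulls for later steps; inclusion keeps all facts derived so
  far available.\<close>

definition extends :: "constraint set \<Rightarrow> db_instance \<Rightarrow> db_instance \<Rightarrow> bool" where
  "extends \<Sigma> J K \<longleftrightarrow> finite K \<and> J \<subseteq> K \<and> (step \<Sigma>)\<^sup>*\<^sup>* J K"

lemma extends_refl: "finite J \<Longrightarrow> extends \<Sigma> J J"
  by (simp add: extends_def)

lemma extends_trans [trans]: "extends \<Sigma> J K \<Longrightarrow> extends \<Sigma> K L \<Longrightarrow> extends \<Sigma> J L"
  by (auto simp: extends_def)

lemma extendsD: "extends \<Sigma> J K \<Longrightarrow> finite K" "extends \<Sigma> J K \<Longrightarrow> A \<in> J \<Longrightarrow> A \<in> K"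
  by (auto simp: extends_def)

lemma finite_nulls: "finite J \<Longrightarrow> finite (nulls J)"
proof -
  have "nulls J = (\<Union>A\<in>J. Null -` set (args A))" by (auto simp: nulls_def)
  then show "finite J \<Longrightarrow> finite (nulls J)" by (auto intro!: finite_vimageI injI)
qed

text \<open>A chase step requires a violated constraint. If the rule is already satisfied, the head
  is present for some \<open>b\<close> and no step is taken; otherwise a step adds it.\<close>

lemma extends_TGD:
  assumes "TGD body head \<in> \<Sigma>" "finite J" "inst a body \<subseteq> J"
  shows "\<exists>b K. extends \<Sigma> J K \<and> (\<forall>x\<in>vars body. b x = a x) \<and> inst b head \<subseteq> K"
proof (cases "sat J (TGD body head) a")
  case True
  then obtain b where "\<forall>x\<in>vars body. b x = a x" "inst b head \<subseteq> J" using assms(3) by auto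
  then show ?thesis using extends_refl[OF assms(2)] by blast
next
  case False
  obtain m where m: "\<And>k. k \<in> nulls J \<Longrightarrow> k < m"
    using finite_nulls[OF assms(2)] by (metis finite_nat_set_iff_bounded)
  \<comment> \<open>All nulls of \<open>J\<close> lie below \<open>m\<close>, so
    \<open>m + x\<close> is fresh, and it differs for different variables.\<close>
  define b where "b x = (if x \<in> vars body then a x else Null (m + x))" for x
  have "inj_on b (ex_vars body head)" "\<forall>y\<in>ex_vars body head. \<exists>n. b y = Null n \<and> n \<notin> nulls J"
    using m by (auto simp: inj_on_def b_def ex_vars_def)
  then have "chase_step J (TGD body head) a (J \<union> inst b head)"
    using False by (intro chase_step.tgd) (auto simp: b_def)
  then have "step \<Sigma> J (J \<union> inst b head)" using assms(1) unfolding step_def by blast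
  then have "extends \<Sigma> J (J \<union> inst b head)"
    using assms(2) by (auto simp: extends_def inst_def)
  then show ?thesis by (auto simp: b_def intro!: exI[of _ b] exI[of _ "J \<union> inst b head"])
qed

text \<open>Without existential variables the derived fact is determined by \<open>a\<close>,
  whichever \<open>b\<close> witnesses the head.\<close>

lemma extends_datalog:
  assumes "TGD body [mk_atom s ts] \<in> \<Sigma>" "finite J" "inst a body \<subseteq> J"
    "\<And>x. Var x \<in> set ts \<Longrightarrow> x \<in> vars body"
  shows "\<exists>K. extends \<Sigma> J K \<and> mk_atom s (map (inst_trm a) ts) \<in> K"
proof -
  obtain b K where K: "extends \<Sigma> J K" "\<And>x. x \<in> vars body \<Longrightarrow> b x = a x"
    "inst b [mk_atom s ts] \<subseteq> K"
    using extends_TGD[OF assms(1-3)] by blast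
  have "inst_trm b t = inst_trm a t" if "t \<in> set ts" for t
    
  proof (cases t)
    case (Var x)
    then show ?thesis using that assms(4)[of x] K(2)[of x] by simp
  qed simp
  then have "map (inst_trm b) ts = map (inst_trm a) ts" by simp
  with K show ?thesis by (auto simp: inst_def)
qed

section \<open>Numbers represented in an instance\<close>

text \<open>\<open>rep J i u\<close>: in \<open>J\<close>, the value \<open>u\<close> is reached from the constant 0 by \<open>i\<close> successor facts.\<close>

primrec rep :: "db_instance \<Rightarrow> nat \<Rightarrow> val \<Rightarrow> bool" where
  "rep J 0 u \<longleftrightarrow> u = Const 0 \<and> mk_atom Num [u] \<in> J"
| "rep J (Suc i) u \<longleftrightarrow>
     mk_atom Num [u] \<in> J \<and> (\<exists>v. rep J i v \<and> mk_atom Successor [v, u] \<in> J)"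

lemma rep_Num: "rep J i u \<Longrightarrow> mk_atom Num [u] \<in> J"
  by (cases i) auto

lemma rep_extends: "rep J i u \<Longrightarrow> extends \<Sigma> J K \<Longrightarrow> rep K i u"
  by (induction i arbitrary: u) (auto dest: extendsD)

lemma reps_extends: "list_all2 (rep J) xs us \<Longrightarrow> extends \<Sigma> J K \<Longrightarrow> list_all2 (rep K) xs us"
  by (erule list_all2_mono) (rule rep_extends)

lemma vars_simps [simp]:
  "vars [] = {}" "vars (A # as) = {x. Var x \<in> set (args A)} \<union> vars as"
  "vars (as @ bs) = vars as \<union> vars bs" "vars (nums k) = {..<k}"
  by (auto simp: vars_def nums_def)

lemma inst_simps [simp]:
  "inst a [] = {}" "inst a (mk_atom s ts # as) = insert (mk_atom s (map (inst_trm a) ts)) (inst a as)"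
  "inst a (as @ bs) = inst a as \<union> inst a bs"
  by (auto simp: inst_def)

text \<open>Valuations are given by indexing a list: first the parameters \<open>us\<close> of a
  rule, then the values of its remaining variables from index \<open>k\<close> on.\<close>

lemma map_inst_tuple [simp]: "length us = k \<Longrightarrow> map (inst_trm ((!) (us @ vs))) (tuple k) = us"
  by (auto simp: tuple_def intro!: nth_equalityI simp: nth_append)

lemma set_tuple [simp]: "Var x \<in> set (tuple k) \<longleftrightarrow> x < k"
  by (auto simp: tuple_def)

lemma inst_nums:
  "list_all2 (rep J) xs us \<Longrightarrow> length us = k \<Longrightarrow> inst ((!) (us @ vs)) (nums k) \<subseteq> J"
  by (auto simp: inst_def nums_def list_all2_conv_all_nth nth_append) (metis rep_Num)

context
  fixes \<Sigma> :: "constraint set"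
  assumes number_rules_subset: "set number_rules \<subseteq> \<Sigma>"
begin

lemma extends_rep_Suc:
  assumes "finite J" "rep J i u"
  shows "\<exists>K v. extends \<Sigma> J K \<and> rep K (Suc i) v \<and> mk_atom Successor [u, v] \<in> K"
proof -
  let ?body = "[mk_atom Num [Var 0]]"
  have "TGD ?body [mk_atom Successor [Var 0, Var 1], mk_atom Num [Var 1]] \<in> \<Sigma>"
    using number_rules_subset by (auto simp: number_rules_def)
  moreover have "inst (\<lambda>_. u) ?body \<subseteq> J" using assms rep_Num by auto
  ultimately have "\<exists>b K. extends \<Sigma> J K \<and> (\<forall>x\<in>vars ?body. b x = u) \<and>
      inst b [mk_atom Successor [Var 0, Var 1], mk_atom Num [Var 1]] \<subseteq> K"
    by (rule extends_TGD[OF _ assms(1)])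
  then obtain b K where K: "extends \<Sigma> J K" "mk_atom Successor [u, b 1] \<in> K" "mk_atom Num [b 1] \<in> K"
    by auto
  then show ?thesis using rep_extends[OF assms(2) K(1)] by (intro exI[of _ K] exI[of _ "b 1"]) auto
qed

text \<open>Induction on the evaluation. A number may be represented by several values, so the claim
  is made for every representing tuple \<open>us\<close>; the instance is arbitrary because facts
  accumulate between subevaluations.\<close>

lemma derive_result:
  assumes "rec_eval q xs y" "set (rules q (length xs)) \<subseteq> \<Sigma>" "finite J" "rep J 0 (Const 0)"
    "list_all2 (rep J) xs us"
  shows "\<exists>K u. extends \<Sigma> J K \<and> rep K y u \<and> mk_atom (Result q) (u # us) \<in> K"
  using assms
proof (induction arbitrary: J us rule: rec_eval.induct)
  case (zero xs)
  then have len: "length us = length xs" by (simp add: list_all2_lengthD)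
  have rule: "TGD (nums (length xs)) [mk_atom (Result Zero) (Cst 0 # tuple (length xs))] \<in> \<Sigma>"
    using zero(1) by simp
  obtain K where "extends \<Sigma> J K" "mk_atom (Result Zero) (Const 0 # us) \<in> K"
    using extends_datalog[OF rule zero(2) inst_nums[OF zero(4) len, of "[]"]]
      map_inst_tuple[OF len, of "[]"] by auto
  then show ?case using zero(3) rep_extends by blast
next
  case (succ x)
  then obtain u where u: "us = [u]" "rep J x u" by (auto simp: list_all2_Cons1)
  \<comment> \<open>The rule for \<open>Succ\<close> only reads successor facts, so a successor of
    the argument is provided first.\<close>
  then obtain K v where K: "extends \<Sigma> J K" "rep K (Suc x) v" "mk_atom Successor [u, v] \<in> K"
    using extends_rep_Suc succ by blast
  have rule: "TGD [mk_atom Successor [Var 0, Var 1]] [mk_atom (Result Succ) [Var 1, Var 0]] \<in> \<Sigma>"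
    using succ(1) by simp
  have "inst ((!) [u, v]) [mk_atom Successor [Var 0, Var 1]] \<subseteq> K" using K(3) by simp
  from extends_datalog[OF rule extendsD(1)[OF K(1)] this]
  obtain L where "extends \<Sigma> K L" "mk_atom (Result Succ) [v, u] \<in> L" by auto
  then show ?case using K u extends_trans rep_extends by blast
next
  case (proj i xs)
  then have len: "length us = length xs" by (simp add: list_all2_lengthD)
  have rule: "TGD (nums (length xs)) [mk_atom (Result (Proj i)) (Var i # tuple (length xs))] \<in> \<Sigma>"
    using proj(1,2) by simp
  obtain K where "extends \<Sigma> J K" "mk_atom (Result (Proj i)) (us ! i # us) \<in> K"
    using extends_datalog[OF rule proj(3) inst_nums[OF proj(5) len, of "[]"]] proj(1)
      map_inst_tuple[OF len, of "[]"] by auto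
  moreover have "rep J (xs ! i) (us ! i)" using proj by (simp add: list_all2_nthD)
  ultimately show ?case using rep_extends by blast
next
  case (comp ys gs xs f z)
  let ?k = "length xs" and ?m = "length gs"
  have len: "length us = ?k" using comp.prems by (simp add: list_all2_lengthD)
  \<comment> \<open>The inner programs are evaluated one after the other, each in the instance left
    by the previous ones.\<close>
  have "\<exists>K vs. extends \<Sigma> J K \<and> length vs = j \<and>
      (\<forall>i<j. rep K (ys ! i) (vs ! i) \<and> mk_atom (Result (gs ! i)) (vs ! i # us) \<in> K)"
    if "j \<le> ?m" for j
    using that
  proof (induction j)
    case 0
    then show ?case using extends_refl comp.prems by auto
  next
    case (Suc j)
    then obtain K vs where K: "extends \<Sigma> J K" "length vs = j"
      "\<And>i. i < j \<Longrightarrow> rep K (ys ! i) (vs ! i) \<and> mk_atom (Result (gs ! i)) (vs ! i # us) \<in> K"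
      by auto
    have "set (rules (gs ! j) ?k) \<subseteq> \<Sigma>"
    proof -
      have "gs ! j \<in> set gs" using Suc.prems by simp
      then have "set (rules (gs ! j) ?k) \<subseteq> set (rules (Comp f gs) ?k)"
        by (simp only: rules.simps set_simps set_append set_concat set_map) blast
      then show ?thesis using comp.prems(1) by (rule subset_trans)
    qed
    then obtain L u where L: "extends \<Sigma> K L" "rep L (ys ! j) u"
      "mk_atom (Result (gs ! j)) (u # us) \<in> L"
      using comp.IH(1)[of j K us] Suc.prems comp.prems K(1)
      by (meson Suc_le_lessD extendsD(1) rep_extends reps_extends)
    show ?case
      using K L extends_trans[OF K(1) L(1)]
      by (intro exI[of _ L] exI[of _ "vs @ [u]"])
        (auto simp: nth_append less_Suc_eq dest: rep_extends extendsD(2))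
  qed
  from this[of ?m] obtain K vs where K: "extends \<Sigma> J K" "length vs = ?m"
    "\<And>i. i < ?m \<Longrightarrow> rep K (ys ! i) (vs ! i)"
    "\<And>i. i < ?m \<Longrightarrow> mk_atom (Result (gs ! i)) (vs ! i # us) \<in> K" by auto
  have "list_all2 (rep K) ys vs" using K comp.hyps by (simp add: list_all2_conv_all_nth)
  then obtain L w where L: "extends \<Sigma> K L" "rep L z w" "mk_atom (Result f) (w # vs) \<in> L"
    using comp.IH(2)[of K vs] comp.prems(1) comp.hyps(1)
      rep_extends[OF comp.prems(3) K(1)] extendsD(1)[OF K(1)]
    by auto
  have JL: "extends \<Sigma> J L" using K L extends_trans by blast
  let ?a = "(!) (us @ vs @ [w])"
  let ?body = "mk_atom (Result f) (Var (?k + ?m) # map Var [?k..<?k + ?m]) #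
      map (\<lambda>j. mk_atom (Result (gs ! j)) (Var (?k + j) # tuple ?k)) [0..<?m] @ nums ?k"
  have "map ?a [?k..<?k + ?m] = vs"
    using len K(2) by (auto simp: nth_append intro!: nth_equalityI)
  moreover have "?a (?k + ?m) = w" "\<And>j. j < ?m \<Longrightarrow> ?a (?k + j) = vs ! j"
    using len K(2) by (auto simp: nth_append)
  ultimately have body: "inst ?a ?body \<subseteq> L"
    using L(3) K(4) len K(2) inst_nums[OF reps_extends[OF comp.prems(4) JL] len, of "vs @ [w]"]
      extendsD(2)[OF L(1)]
    by (auto simp: comp_def inst_def[of _ "map _ _"])
  have rule: "TGD ?body [mk_atom (Result (Comp f gs)) (Var (?k + ?m) # tuple ?k)] \<in> \<Sigma>"
    using comp.prems(1) by simp
  obtain M where M: "extends \<Sigma> L M" "mk_atom (Result (Comp f gs)) (w # us) \<in> M"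
    using extends_datalog[OF rule extendsD(1)[OF JL] body] len K(2) by (auto simp: nth_append)
  show ?case using extends_trans[OF JL M(1)] rep_extends[OF L(2) M(1)] M(2) by blast
next
  case (primrec_0 f xs y g)
  let ?k = "length xs"
  from primrec_0.prems obtain vs where us: "us = Const 0 # vs" "list_all2 (rep J) xs vs"
    by (auto simp: list_all2_Cons1)
  then have len: "length vs = ?k" by (simp add: list_all2_lengthD)
  obtain K u where K: "extends \<Sigma> J K" "rep K y u" "mk_atom (Result f) (u # vs) \<in> K"
    using primrec_0.IH[OF _ _ _ us(2)] primrec_0.prems by auto
  let ?a = "(!) (vs @ [u])"
  have body: "inst ?a [mk_atom (Result f) (Var ?k # tuple ?k)] \<subseteq> K" using K(3) len by (simp add: nth_append)
  have rule: "TGD [mk_atom (Result f) (Var ?k # tuple ?k)]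
      [mk_atom (Result (PrimRec f g)) (Var ?k # Cst 0 # tuple ?k)] \<in> \<Sigma>"
    using primrec_0.prems(1) by simp
  obtain L where L: "extends \<Sigma> K L"
    "mk_atom (Result (PrimRec f g)) (u # Const 0 # vs) \<in> L"
    using extends_datalog[OF rule extendsD(1)[OF K(1)] body] len by (auto simp: nth_append)
  show ?case using extends_trans[OF K(1) L(1)] rep_extends[OF K(2) L(1)] L(2) us(1) by blast
next
  case (primrec_Suc f g n xs r y)
  let ?k = "length xs"
  \<comment> \<open>\<open>rep\<close> at \<open>Suc n\<close> yields a predecessor \<open>v\<close>
    of \<open>u\<close>. Recursing on \<open>v\<close> lets the final result be attached to the
    given value \<open>u\<close>.\<close>
  from primrec_Suc.prems obtain u v vs where us: "us = u # vs" "list_all2 (rep J) xs vs"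
    and v: "rep J n v" "mk_atom Successor [v, u] \<in> J"
    by (auto simp: list_all2_Cons1)
  then have len: "length vs = ?k" by (simp add: list_all2_lengthD)
  obtain K w where K: "extends \<Sigma> J K" "rep K r w" "mk_atom (Result (PrimRec f g)) (w # v # vs) \<in> K"
    using primrec_Suc.IH(1)[of J "v # vs"] primrec_Suc.prems us v by auto
  obtain L t where L: "extends \<Sigma> K L" "rep L y t" "mk_atom (Result g) (t # v # w # vs) \<in> L"
    using primrec_Suc.IH(2)[of K "v # w # vs", OF _ extendsD(1)[OF K(1)]] primrec_Suc.prems(1)
      K(2) rep_extends[OF primrec_Suc.prems(3) K(1)] rep_extends[OF v(1) K(1)]
      reps_extends[OF us(2) K(1)]
    by auto
  have JL: "extends \<Sigma> J L" using K L extends_trans by blast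
  \<comment> \<open>In order: previous result, predecessor, new result, recursion argument.\<close>
  let ?a = "(!) (vs @ [w, v, t, u])"
  let ?body = "[mk_atom (Result (PrimRec f g)) (Var ?k # Var (?k + 1) # tuple ?k),
          mk_atom (Result g) (Var (?k + 2) # Var (?k + 1) # Var ?k # tuple ?k),
          mk_atom Successor [Var (?k + 1), Var (?k + 3)]]"
  have body: "inst ?a ?body \<subseteq> L"
    using K(3) L(3) v(2) len extendsD(2)[OF JL] extendsD(2)[OF L(1)]
    by (simp add: nth_append numeral_eq_Suc)
  have rule: "TGD ?body
      [mk_atom (Result (PrimRec f g)) (Var (?k + 2) # Var (?k + 3) # tuple ?k)] \<in> \<Sigma>"
    using primrec_Suc.prems(1) by simp
  obtain M where M: "extends \<Sigma> L M"
    "mk_atom (Result (PrimRec f g)) (t # u # vs) \<in> M"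
    using extends_datalog[OF rule extendsD(1)[OF JL] body] len by (auto simp: nth_append numeral_eq_Suc)
  show ?case using extends_trans[OF JL M(1)] rep_extends[OF L(2) M(1)] M(2) us(1) by blast
next
  case (mu f n xs)
  let ?k = "length xs"
  have len: "length us = ?k" using mu.prems by (simp add: list_all2_lengthD)
  \<comment> \<open>The search is replayed up to \<open>n\<close>, raising the bound of
    \<open>Positive_below\<close> one number at a time.\<close>
  have "\<exists>K v. extends \<Sigma> J K \<and> rep K m v \<and> mk_atom (Positive_below f) (v # us) \<in> K"
    if "m \<le> n" for m
    using that
  proof (induction m)
    case 0
    have rule: "TGD (nums ?k) [mk_atom (Positive_below f) (Cst 0 # tuple ?k)] \<in> \<Sigma>"
      using mu.prems(1) by simp
    obtain K where "extends \<Sigma> J K" "mk_atom (Positive_below f) (Const 0 # us) \<in> K"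
      using extends_datalog[OF rule mu.prems(2) inst_nums[OF mu.prems(4) len, of "[]"]]
        map_inst_tuple[OF len, of "[]"] by auto
    then show ?case using mu.prems(3) rep_extends by blast
  next
    case (Suc m)
    then obtain K v where K: "extends \<Sigma> J K" "rep K m v"
      "mk_atom (Positive_below f) (v # us) \<in> K" by auto
    obtain y where "\<And>J us. set (rules f (length (m # xs))) \<subseteq> \<Sigma> \<Longrightarrow> finite J \<Longrightarrow>
        rep J 0 (Const 0) \<Longrightarrow> list_all2 (rep J) (m # xs) us \<Longrightarrow>
        \<exists>K u. extends \<Sigma> J K \<and> rep K (Suc y) u \<and> mk_atom (Result f) (u # us) \<in> K"
      using mu.IH(2)[of m] Suc.prems by (meson Suc_le_lessD)
    from this[of K "v # us"] obtain L w where L: "extends \<Sigma> K L" "rep L (Suc y) w"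
      "mk_atom (Result f) (w # v # us) \<in> L"
      using mu.prems(1) extendsD(1)[OF K(1)] K(2) rep_extends[OF mu.prems(3) K(1)]
        reps_extends[OF mu.prems(4) K(1)]
      by auto
    \<comment> \<open>The predecessor \<open>w'\<close> certifies that the value \<open>w\<close> of
      \<open>f\<close> is positive.\<close>
    obtain w' where w': "mk_atom Successor [w', w] \<in> L" using L(2) by auto
    obtain M v' where M: "extends \<Sigma> L M" "rep M (Suc m) v'" "mk_atom Successor [v, v'] \<in> M"
      using extends_rep_Suc[OF extendsD(1)[OF L(1)] rep_extends[OF K(2) L(1)]] by blast
    have JM: "extends \<Sigma> J M" using K L M extends_trans by blast
    let ?a = "(!) (us @ [v, w, w', v'])"
    let ?body = "[mk_atom (Positive_below f) (Var ?k # tuple ?k),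
          mk_atom (Result f) (Var (?k + 1) # Var ?k # tuple ?k),
          mk_atom Successor [Var (?k + 2), Var (?k + 1)],
          mk_atom Successor [Var ?k, Var (?k + 3)]]"
    have body: "inst ?a ?body \<subseteq> M"
      using K(3) L(3) w' M(3) len extendsD(2)[OF M(1)] extendsD(2)[OF L(1)]
      by (simp add: nth_append numeral_eq_Suc)
    have rule: "TGD ?body [mk_atom (Positive_below f) (Var (?k + 3) # tuple ?k)] \<in> \<Sigma>"
      using mu.prems(1) by simp
    obtain N where N: "extends \<Sigma> M N" "mk_atom (Positive_below f) (v' # us) \<in> N"
      using extends_datalog[OF rule extendsD(1)[OF JM] body] len by (auto simp: nth_append numeral_eq_Suc)
    show ?case using extends_trans[OF JM N(1)] rep_extends[OF M(2) N(1)] N(2) by blast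
  qed
  then obtain K v where K: "extends \<Sigma> J K" "rep K n v"
    "mk_atom (Positive_below f) (v # us) \<in> K" by blast
  \<comment> \<open>\<open>rep\<close> at 0 forces the result to be \<open>Const 0\<close>, as
    \<open>Cst 0\<close> in the rule requires.\<close>
  then obtain L where L: "extends \<Sigma> K L" "mk_atom (Result f) (Const 0 # v # us) \<in> L"
    using mu.IH(1)[of K "v # us"] mu.prems(1) extendsD(1)[OF K(1)]
      rep_extends[OF mu.prems(3) K(1)] reps_extends[OF mu.prems(4) K(1)]
    by auto
  have JL: "extends \<Sigma> J L" using K L extends_trans by blast
  let ?a = "(!) (us @ [v])"
  let ?body = "[mk_atom (Positive_below f) (Var ?k # tuple ?k),
          mk_atom (Result f) (Cst 0 # Var ?k # tuple ?k)]"
  have body: "inst ?a ?body \<subseteq> L"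
    using K(3) L(2) len extendsD(2)[OF L(1)] by (simp add: nth_append)
  have rule: "TGD ?body [mk_atom (Result (Mu f)) (Var ?k # tuple ?k)] \<in> \<Sigma>"
    using mu.prems(1) by simp
  obtain M where M: "extends \<Sigma> L M" "mk_atom (Result (Mu f)) (v # us) \<in> M"
    using extends_datalog[OF rule extendsD(1)[OF JL] body] len by (auto simp: nth_append)
  show ?case
    using extends_trans[OF JL M(1)] rep_extends[OF rep_extends[OF K(2) L(1)] M(1)] M(2) by blast
qed

end

section \<open>Replaying an accepting evaluation\<close>

lemma accepts_imp_derives_goal:
  assumes "rec_eval D [n] 1"
  shows "\<exists>K. (step (set (program_rules D)))\<^sup>*\<^sup>* (set (input_facts n)) K \<and> mk_atom Goal [] \<in> K"
proof -
  let ?\<Sigma> = "set (program_rules D)" and ?I = "set (input_facts n)"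
  have number: "set number_rules \<subseteq> ?\<Sigma>" by (auto simp: program_rules_def)
  have chain: "mk_atom Successor [Const i, Const (Suc i)] \<in> ?I" if "i < n" for i
    using that by (induction n) (auto simp: input_facts_def less_Suc_eq)
  \<comment> \<open>The input contains no \<open>Num\<close> facts; they are derived along the
    chain, so that \<open>Const n\<close> comes to represent \<open>n\<close>.\<close>
  have "\<exists>J. extends ?\<Sigma> ?I J \<and> rep J 0 (Const 0) \<and> rep J i (Const i)" if "i \<le> n" for i
    using that
  proof (induction i)
    case 0
    have "TGD [] [mk_atom Num [Cst 0]] \<in> ?\<Sigma>"
      using number by (auto simp: number_rules_def)
    from extends_datalog[OF this, of ?I undefined] show ?case by auto
  next
    case (Suc i)
    then obtain J where J: "extends ?\<Sigma> ?I J" "rep J 0 (Const 0)" "rep J i (Const i)" by auto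
    have rule: "TGD [mk_atom Successor [Var 0, Var 1]] [mk_atom Num [Var 1]] \<in> ?\<Sigma>"
      using number by (auto simp: number_rules_def)
    have succ: "mk_atom Successor [Const i, Const (Suc i)] \<in> J"
      using chain Suc.prems extendsD(2)[OF J(1)] by simp
    then have "inst ((!) [Const i, Const (Suc i)]) [mk_atom Successor [Var 0, Var 1]] \<subseteq> J" by simp
    from extends_datalog[OF rule extendsD(1)[OF J(1)] this]
    obtain K where K: "extends ?\<Sigma> J K" "mk_atom Num [Const (Suc i)] \<in> K" by auto
    moreover have "rep K 0 (Const 0)" "rep K i (Const i)" using J(2,3) rep_extends[OF _ K(1)] by blast+
    ultimately show ?case
      using extends_trans[OF J(1) K(1)] extendsD(2)[OF K(1) succ] by auto
  qed
  then obtain J where J: "extends ?\<Sigma> ?I J" "rep J 0 (Const 0)" "rep J n (Const n)" by blast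
  obtain K u where K: "extends ?\<Sigma> J K" "rep K 1 u" "mk_atom (Result D) [u, Const n] \<in> K"
    using derive_result[OF number assms _ extendsD(1)[OF J(1)] J(2), of "[Const n]"] J(3)
    by (auto simp: program_rules_def)
  have IK: "extends ?\<Sigma> ?I K" using J K extends_trans by blast
  \<comment> \<open>Unfolding \<open>rep K 1 u\<close> gives the successor fact from
    \<open>Const 0\<close> to \<open>u\<close>.\<close>
  have "inst ((!) [Const n, u]) [mk_atom Start [Var 0], mk_atom (Result D) [Var 1, Var 0],
      mk_atom Successor [Cst 0, Var 1]] \<subseteq> K"
    using K extendsD(2)[OF IK, of "mk_atom Start [Const n]"] by (auto simp: input_facts_def)
  from extends_datalog[OF _ extendsD(1)[OF IK] this, of Accept "[]" ?\<Sigma>]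
  obtain L where L: "extends ?\<Sigma> K L" "mk_atom Accept [] \<in> L"
    by (auto simp: program_rules_def accept_rule_def)
  from extends_datalog[OF _ extendsD(1)[OF L(1)], of "[mk_atom Accept []]" Goal "[]" ?\<Sigma> undefined]
  obtain M where "extends ?\<Sigma> L M" "mk_atom Goal [] \<in> M"
    using L(2) by (auto simp: program_rules_def goal_rule_def)
  then show ?thesis using extends_trans[OF extends_trans[OF IK L(1)]] by (auto simp: extends_def)
qed

section \<open>From finite derivations to exhaustive chase sequences\<close>

lemma chase_sequence_exists: "\<exists>N J c a. chase_sequence I \<Sigma> N J c a"
proof -
  define nxt where "nxt J = (SOME (\<beta>, a, K). \<beta> \<in> \<Sigma> \<and> chase_step J \<beta> a K)" for J
  have nxt: "case nxt J of (\<beta>, a, K) \<Rightarrow> \<beta> \<in> \<Sigma> \<and> chase_step J \<beta> a K"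
    if "\<exists>\<beta>\<in>\<Sigma>. \<exists>a K. chase_step J \<beta> a K" for J
    unfolding nxt_def by (rule someI_ex) (use that in auto)
  define J where "J i = ((\<lambda>J. snd (snd (nxt J))) ^^ i) I" for i
  let ?stop = "\<lambda>i. \<not> (\<exists>\<beta>\<in>\<Sigma>. \<exists>a K. chase_step (J i) \<beta> a K)"
  \<comment> \<open>Chosen steps are iterated up to the first instance that admits none, or
    forever.\<close>
  define N where "N = (if \<exists>i. ?stop i then enat (LEAST i. ?stop i) else \<infinity>)"
  have "fst (nxt (J i)) \<in> \<Sigma> \<and> chase_step (J i) (fst (nxt (J i))) (fst (snd (nxt (J i)))) (J (Suc i))"
    if "enat i < N" for i
  proof -
    have "\<not> ?stop i" using that not_less_Least[of i ?stop] by (auto simp: N_def split: if_splits)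
    then show ?thesis using nxt[of "J i"] by (auto simp: J_def split: prod.splits)
  qed
  moreover have "?stop n" if "N = enat n" for n
  proof -
    from that obtain k where "?stop k" "n = (LEAST i. ?stop i)"
      by (auto simp: N_def split: if_splits)
    then show ?thesis using LeastI[of ?stop k] by blast
  qed
  ultimately have "chase_sequence I \<Sigma> N J (\<lambda>i. fst (nxt (J i))) (\<lambda>i. fst (snd (nxt (J i))))"
    unfolding chase_sequence_def by (simp add: J_def)
  then show ?thesis by blast
qed

lemma chase_sequence_Cons:
  assumes "\<beta> \<in> \<Sigma>" "chase_step I \<beta> b K" "chase_sequence K \<Sigma> N J c a"
  shows "chase_sequence I \<Sigma> (eSuc N) (case_nat I J) (case_nat \<beta> c) (case_nat b a)"
proof -
  have "\<exists>m. n = Suc m \<and> N = enat m" if "eSuc N = enat n" for n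
    using that by (cases N; cases n) (auto simp: eSuc_enat enat_0_iff)
  moreover have "enat i < N" if "enat (Suc i) < eSuc N" for i
    using that by (simp flip: eSuc_enat)
  ultimately show ?thesis
    using assms unfolding chase_sequence_def by (fastforce split: nat.split)
qed

text \<open>All constraints of \<open>program_rules D\<close> are TGDs, and \<open>Goal\<close>
  occurs in the head of \<open>goal_rule\<close> only.\<close>

lemma Goal_step:
  assumes "\<beta> \<in> set (program_rules D)" "chase_step J \<beta> a K" "mk_atom Goal [] \<notin> J" "mk_atom Goal [] \<in> K"
  shows "\<beta> = goal_rule"
proof (rule ccontr)
  assume "\<beta> \<noteq> goal_rule"
  have "\<exists>body head. \<beta> = TGD body head \<and> (\<forall>b. mk_atom Goal [] \<notin> inst b head)"
    if "\<beta> \<in> set (rules q k)" for q k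
    using that by (induction q k rule: rules.induct) (auto split: if_splits)
  then have "\<exists>body head. \<beta> = TGD body head \<and> (\<forall>b. mk_atom Goal [] \<notin> inst b head)"
    using assms(1) \<open>\<beta> \<noteq> goal_rule\<close>
    by (auto simp: program_rules_def accept_rule_def number_rules_def)
  with assms(2-4) show False by (auto elim: chase_step.cases)
qed

text \<open>The step that first produces \<open>Goal\<close> applies \<open>goal_rule\<close>. Any
  exhaustive continuation from there, prefixed by the derivation up to it, is a chase sequence that
  applies this rule.\<close>

lemma derives_goal_imp_relevant:
  assumes "(step (set (program_rules D)))\<^sup>*\<^sup>* I K" "mk_atom Goal [] \<notin> I" "mk_atom Goal [] \<in> K"
  shows "\<not> irrelevant I (set (program_rules D)) goal_rule"
  using assms
proof (induction rule: converse_rtranclp_induct)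
  case (step I J)
  then obtain \<beta> b where \<beta>: "\<beta> \<in> set (program_rules D)" "chase_step I \<beta> b J"
    by (auto simp: step_def)
  show ?case
  proof (cases "mk_atom Goal [] \<in> J")
    case True
    with Goal_step[OF \<beta>] step.prems have "\<beta> = goal_rule" by blast
    moreover obtain N Js c a where "chase_sequence J (set (program_rules D)) N Js c a"
      using chase_sequence_exists by blast
    from chase_sequence_Cons[OF \<beta> this] have
      "chase_sequence I (set (program_rules D)) (eSuc N) (case_nat I Js) (case_nat \<beta> c) (case_nat b a)" .
    moreover have "enat 0 < eSuc N" by (simp add: zero_enat_def[symmetric])
    moreover have "case_nat \<beta> c 0 = \<beta>" by simp
    ultimately show ?thesis unfolding irrelevant_def by blast
  next
    case False
    with step.IH step.prems obtain N Js c a i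
      where seq: "chase_sequence J (set (program_rules D)) N Js c a"
      and i: "enat i < N" "c i = goal_rule"
      by (auto simp: irrelevant_def)
    have "enat (Suc i) < eSuc N" "case_nat \<beta> c (Suc i) = goal_rule"
      using i by (simp_all flip: eSuc_enat)
    with chase_sequence_Cons[OF \<beta> seq] show ?thesis unfolding irrelevant_def by blast
  qed
qed simp

lemma irrelevant_iff:
  "irrelevant (set (input_facts n)) (set (program_rules D)) goal_rule \<longleftrightarrow> \<not> rec_eval D [n] 1"
proof -
  have "mk_atom Goal [] \<notin> set (successor_chain n)" for n by (induction n) auto
  then have "mk_atom Goal [] \<notin> set (input_facts n)" by (simp add: input_facts_def)
  then show ?thesis
    using relevant_imp_accepts accepts_imp_derives_goal derives_goal_imp_relevant by blast
qed

section \<open>Undecidability\<close>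

theorem theorem2:
  "\<not> decidable_on valid_inputs encode_input
      (\<lambda>(\<Sigma>, \<alpha>, I). irrelevant (set I) (set \<Sigma>) \<alpha>)"
proof
  assume "decidable_on valid_inputs encode_input (\<lambda>(\<Sigma>, \<alpha>, I). irrelevant (set I) (set \<Sigma>) \<alpha>)"
  then obtain p where p: "(\<Sigma>, \<alpha>, I) \<in> valid_inputs \<Longrightarrow>
      rec_eval p [encode_input (\<Sigma>, \<alpha>, I)] (if irrelevant (set I) (set \<Sigma>) \<alpha> then 1 else 0)"
    for \<Sigma> \<alpha> I
    unfolding decidable_on_def by fast
  let ?h = "\<lambda>m. prod_encode (m,
    prod_encode (encode_constraint goal_rule, encode_atoms encode_val (input_facts m)))"
  from computable_input_code obtain H where H: "rec_eval H [m] (?h m)" for m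
    unfolding computable_def by (metis One_nat_def length_Cons list.size(3) nth_Cons_0)
  define D where "D = Comp p [H]"
  \<comment> \<open>The diagonal choice: on \<open>n\<close>, \<open>H\<close> produces the code of
    the input built from the rules of \<open>D\<close> itself.\<close>
  define n where "n = list_encode (map encode_constraint (program_rules D))"
  let ?irr = "irrelevant (set (input_facts n)) (set (program_rules D)) goal_rule"
  have "rec_eval p [?h n] (if ?irr then 1 else 0)"
    using p[OF valid_input[of D n]] by (simp add: n_def)
  then have "rec_eval D [n] (if ?irr then 1 else 0)"
    unfolding D_def using H by (intro rec_eval.comp[of "[?h n]"]) auto
  \<comment> \<open>If \<open>?irr\<close> holds, \<open>D\<close> outputs 1, which
    \<open>irrelevant_iff\<close> forbids; otherwise \<open>D\<close> outputs 0, while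
    \<open>irrelevant_iff\<close> demands 1.\<close>
  then show False
    using irrelevant_iff[of n D] rec_eval_deterministic by (cases ?irr) fastforce+
qed

end
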